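(* For every constant $c_1>0$ there exist constants $c_2>0$, $c_3>0$ and $n_0$, depending only on $c_1$, such that for every $n\ge n_0$ the following holds: if $P\subset\mathbb{R}^2$ is a set of $n$ points determining at least $c_1 n^{4/3}$ unordered pairs of points at distance exactly $1$, then there are at least $c_2 n$ points $p\in P$ such that $p$ is at distance exactly $1$ from at least $c_3 n^{1/3}$ other points of $P$. *)

theory Defs
  imports "HOL-Analysis.Analysis"
begin

definition unit_distance_pairs :: "(real ^ 2) set \<Rightarrow> (real ^ 2) set set" where
  "unit_distance_pairs P = {{p, q} | p q. p \<in> P \<and> q \<in> P \<and> dist p q = 1}"

definition unit_neighbours :: "(real ^ 2) set \<Rightarrow> real ^ 2 \<Rightarrow> (real ^ 2) set" where
  "unit_neighbours P p = {q \<in> P. q \<noteq> p \<and> dist p q = 1}"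

end

theory Submission
  imports Defs
begin

text \<open>
  Let \<open>A\<close> be the set of points of large degree. Points outside \<open>A\<close> account for at most half of the
  unit distances, so it suffices to see that few points \<open>A\<close> cannot have \<open>\<Omega>(n\<^sup>4\<^sup>/\<^sup>3)\<close> incidences
  between their unit circles and \<open>P\<close>. Every unit vector lies, up to a reflection, on the lower arc of
  the unit circle over \<open>[-4/5, 4/5]\<close>, and this arc extends to the graph of a strictly convex function
  on the whole line, any two translates of which meet at most once.

  For such pseudolines the incidence bound follows by Szekely's crossing argument. Cutting the curves
  at the points gives \<open>x\<close>-monotone arcs. A crossing-free family of arcs has linear size, which is
  shown by a charging argument rather than by Euler's formula. A random sample of the
  points, each taken with probability \<open>p\<close>, turns this into \<open>p\<^sup>2 e \<le> 4 p n + p\<^sup>4 c\<close> for the numbers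
  \<open>e\<close> of arcs and \<open>c \<le> |A|\<^sup>2\<close> of crossings; taking \<open>p\<close> to be a large multiple of \<open>n\<^sup>-\<^sup>1\<^sup>/\<^sup>3\<close> concludes.
\<close>

section \<open>Plane families of arcs\<close>

text \<open>By the intermediate value theorem a change of order would force a common value strictly
  inside. Equality at \<open>m\<close> is allowed, because \<open>m\<close> may be an abscissa where
  the curves meet.\<close>

lemma less_persists_left:
  fixes f g :: "real \<Rightarrow> real"
  assumes "continuous_on UNIV f" "continuous_on UNIV g" "m < s" "f s < g s"
    and "\<And>u. m < u \<Longrightarrow> u < s \<Longrightarrow> f u \<noteq> g u"
  shows "f m \<le> g m"
proof (rule ccontr)
  assume "\<not> f m \<le> g m"
  moreover have "continuous_on {m..s} (\<lambda>u. f u - g u)"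
    by (intro continuous_on_diff continuous_on_subset[OF assms(1)] continuous_on_subset[OF assms(2)]) auto
  ultimately obtain u where "m \<le> u" "u \<le> s" "f u - g u = 0"
    using IVT2'[of "\<lambda>u. f u - g u" s 0 m] assms(3,4) by auto
  then show False
    using assms(4,5) \<open>\<not> f m \<le> g m\<close> by (cases "u = m"; cases "u = s") auto
qed

lemma less_persists_right:
  fixes f g :: "real \<Rightarrow> real"
  assumes "continuous_on UNIV f" "continuous_on UNIV g" "s < m" "f s < g s"
    and "\<And>u. s < u \<Longrightarrow> u < m \<Longrightarrow> f u \<noteq> g u"
  shows "f m \<le> g m"
proof (rule ccontr)
  assume "\<not> f m \<le> g m"
  moreover have "continuous_on {s..m} (\<lambda>u. f u - g u)"
    by (intro continuous_on_diff continuous_on_subset[OF assms(1)] continuous_on_subset[OF assms(2)]) auto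
  ultimately obtain u where "s \<le> u" "u \<le> m" "f u - g u = 0"
    using IVT'[of "\<lambda>u. f u - g u" s 0 m] assms(3,4) by auto
  then show False
    using assms(4,5) \<open>\<not> f m \<le> g m\<close> by (cases "u = m"; cases "u = s") auto
qed

lemma eventually_at_left_less:
  fixes f g :: "real \<Rightarrow> real"
  assumes "continuous_on UNIV f" "continuous_on UNIV g" "f z < g z"
  shows "\<forall>\<^sub>F s in at_left z. f s < g s"
proof -
  have "((\<lambda>s. g s - f s) \<longlongrightarrow> g z - f z) (at_left z)"
    using assms(1,2)
    by (intro tendsto_diff) (auto simp: continuous_on_def intro: tendsto_within_subset)
  from order_tendstoD(1)[OF this, of 0] assms(3) show ?thesis
    by (auto elim: eventually_mono)
qed

section \<open>Arcs cut out of pseudolines\<close>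

type_synonym arc = "(real \<Rightarrow> real) \<times> real \<times> real"

text \<open>A triple \<open>(f, x, y)\<close> stands for the graph of \<open>f\<close> over
  \<open>[x, y]\<close>. The open intervals ensure that arcs meeting only at an endpoint do not
  cross.\<close>

fun crossing :: "arc \<Rightarrow> arc \<Rightarrow> bool" where
  "crossing (f, x, y) (g, x', y') \<longleftrightarrow>
     f \<noteq> g \<and> (\<exists>z. x < z \<and> z < y \<and> x' < z \<and> z < y' \<and> f z = g z)"

locale pseudolines =
  fixes F :: "(real \<Rightarrow> real) set"
  assumes finite_F: "finite F"
    and cont: "f \<in> F \<Longrightarrow> continuous_on UNIV f"
    and meet_once: "f \<in> F \<Longrightarrow> g \<in> F \<Longrightarrow> f \<noteq> g \<Longrightarrow> f x = g x \<Longrightarrow> f y = g y \<Longrightarrow> x = y"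
begin

definition arcs :: "(real \<times> real) set \<Rightarrow> arc set" where
  "arcs V = {(f, x, y). f \<in> F \<and> x < y \<and> (x, f x) \<in> V \<and> (y, f y) \<in> V \<and>
     (\<forall>z. x < z \<longrightarrow> z < y \<longrightarrow> (z, f z) \<notin> V)}"

lemma finite_arcs:
  assumes "finite V" shows "finite (arcs V)"
proof (rule finite_subset)
  show "arcs V \<subseteq> F \<times> fst ` V \<times> fst ` V"
    by (force simp: arcs_def)
qed (use assms finite_F in auto)

text \<open>If overlapping pieces of one curve differed, an endpoint of one would be interior to the
  other, but interiors avoid \<open>V\<close>.\<close>

lemma arcs_unique:
  assumes "(f, x, y) \<in> arcs V" "(f, x', y') \<in> arcs V" "x < s" "s < y" "x' < s" "s < y'"
  shows "(f, x, y) = (f, x', y')"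
proof -
  have "\<not> x < x'" "\<not> x' < x" "\<not> y < y'" "\<not> y' < y"
    using assms unfolding arcs_def by (auto dest: less_trans)
  then show ?thesis by auto
qed

text \<open>The single permitted meeting happens at \<open>x\<close>, so the order cannot change to
  the right of it.\<close>

lemma less_right:
  assumes "f \<in> F" "g \<in> F" "f x = g x" "x < s" "x < r" "f s < g s"
  shows "f r < g r"
proof -
  have ne: "f u \<noteq> g u" if "u > x" for u
    using meet_once[OF assms(1,2), of x u] assms(3,6) that by auto
  have "f r \<le> g r"
    using less_persists_left[OF cont[OF assms(1)] cont[OF assms(2)], of r s]
      less_persists_right[OF cont[OF assms(1)] cont[OF assms(2)], of s r] ne assms
    by (cases r s rule: linorder_cases) auto
  then show ?thesis using ne[OF assms(5)] by linarith
qed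

end

section \<open>Crossing-free families of arcs\<close>

locale plane_arcs = pseudolines F for F +
  fixes V :: "(real \<times> real) set" and D :: "arc set"
  assumes finite_V: "finite V"
    and D_arcs: "D \<subseteq> arcs V"
    and noncrossing: "d \<in> D \<Longrightarrow> d' \<in> D \<Longrightarrow> \<not> crossing d d'"
begin

lemma finite_D: "finite D"
  using finite_subset[OF D_arcs finite_arcs[OF finite_V]] .

lemma arcD:
  assumes "(f, x, y) \<in> D"
  shows "f \<in> F" "x < y" "(x, f x) \<in> V" "(y, f y) \<in> V"
    "\<And>z. x < z \<Longrightarrow> z < y \<Longrightarrow> (z, f z) \<notin> V"
  using assms D_arcs by (auto simp: arcs_def)

lemma arc_unique:
  assumes "(f, x, y) \<in> D" "(f, x', y') \<in> D" "x < s" "s < y" "x' < s" "s < y'"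
  shows "(f, x, y) = (f, x', y')"
  using arcs_unique assms D_arcs by blast

lemma arc_unique_left:
  assumes "(f, x, y) \<in> D" "(f, x, y') \<in> D"
  shows "(f, x, y) = (f, x, y')"
  using arc_unique[OF assms, of "(x + min y y') / 2"] arcD(2)[OF assms(1)] arcD(2)[OF assms(2)]
  by (auto simp: min_def split: if_splits)

lemma arc_unique_right:
  assumes "(f, x, y) \<in> D" "(f, x', y) \<in> D"
  shows "(f, x, y) = (f, x', y)"
  using arc_unique[OF assms, of "(max x x' + y) / 2"] arcD(2)[OF assms(1)] arcD(2)[OF assms(2)]
  by (auto simp: max_def split: if_splits)

text \<open>Two pseudolines through a common point keep their vertical order to its right, so the
  order can be read off at abscissa \<open>x + 1\<close>, even beyond the ends of the arcs.\<close>

fun above :: "arc \<Rightarrow> arc \<Rightarrow> bool" where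
  "above (f, x, y) (g, x', y') \<longleftrightarrow> x' = x \<and> f x = g x \<and> f (x + 1) < g (x + 1)"

definition next_above :: "arc \<Rightarrow> arc \<Rightarrow> bool" where
  "next_above d d' \<longleftrightarrow> above d d' \<and> (\<forall>e\<in>D. \<not> (above d e \<and> above e d'))"

lemma above_less:
  assumes "(f, x, y) \<in> D" "(g, x, y') \<in> D" "above (f, x, y) (g, x, y')" "x < s"
  shows "f s < g s"
  using less_right[OF arcD(1)[OF assms(1)] arcD(1)[OF assms(2)], of x "x + 1" s] assms(3,4) by auto

text \<open>An arc above \<open>d\<close> with least value at \<open>x + 1\<close> leaves no arc in
  between.\<close>

lemma ex_next_above:
  assumes "d \<in> D" "d' \<in> D" "above d d'"
  shows "\<exists>e\<in>D. next_above d e"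
proof -
  obtain f x y where d: "d = (f, x, y)" by (cases d)
  define S where "S = {e \<in> D. above d e}"
  have "finite S" using finite_D by (auto simp: S_def)
  moreover have "S \<noteq> {}" using assms by (fastforce simp: S_def)
  ultimately have "finite S" "S \<noteq> {}" by auto
  from ex_is_arg_min_if_finite[OF this, of "\<lambda>e. fst e (x + 1)"]
  obtain e where e: "e \<in> S" "\<And>e'. e' \<in> S \<Longrightarrow> \<not> fst e' (x + 1) < fst e (x + 1)"
    unfolding is_arg_min_def by blast
  have "next_above d e"
    unfolding next_above_def
  proof (intro conjI ballI notI)
    show "above d e" using e(1) by (simp add: S_def)
    fix e' assume "e' \<in> D" and *: "above d e' \<and> above e' e"
    then have "\<not> fst e' (x + 1) < fst e (x + 1)" using e(2) by (simp add: S_def)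
    then show False using * by (cases e; cases e') (simp add: d)
  qed
  then show ?thesis using e by (auto simp: S_def)
qed

section \<open>Wedges free of vertices\<close>

text \<open>An arc and its successor bound a wedge that opens at their common left end, the apex.
  The vertical line at \<open>z\<close> is exempt from the emptiness condition, since it will carry
  the charged vertex.\<close>

fun gap :: "arc \<Rightarrow> arc \<Rightarrow> real \<Rightarrow> bool" where
  "gap (f, x, y) (g, x', y') z \<longleftrightarrow> (f, x, y) \<in> D \<and> (g, x', y') \<in> D \<and>
     next_above (f, x, y) (g, x', y') \<and> x < z \<and> z \<le> y \<and> z \<le> y' \<and>
     (\<forall>s t. x < s \<longrightarrow> s < z \<longrightarrow> f s \<le> t \<longrightarrow> t \<le> g s \<longrightarrow> (s, t) \<notin> V)"

lemma gapD:
  assumes "gap (f, x, y) (g, x', y') z"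
  shows "(f, x, y) \<in> D" "(g, x', y') \<in> D" "x' = x" "f x = g x" "x < z" "z \<le> y" "z \<le> y'"
    "\<And>s. x < s \<Longrightarrow> f s < g s"
proof -
  show *: "(f, x, y) \<in> D" "(g, x', y') \<in> D" "x' = x" "f x = g x" "x < z" "z \<le> y" "z \<le> y'"
    using assms by (auto simp: next_above_def)
  show "f s < g s" if "x < s" for s
    using above_less[of f x y g y' s] * that assms by (auto simp: next_above_def)
qed

text \<open>Followed to the left, an arc inside the wedge cannot cross either side. So it starts at
  a vertex inside the wedge, or starts at the apex between two consecutive arcs, or has the apex in
  its interior; all three are excluded.\<close>

lemma gap_no_arc:
  assumes gap: "gap (f, x, y) (g, x', y') z" and h: "(h, x1, y1) \<in> D"
    and s: "x < s" "s < z" "x1 < s" "s < y1" "f s < h s" "h s < g s"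
  shows False
proof -
  note g = gapD[OF gap]
  note F = arcD(1)[OF g(1)] arcD(1)[OF g(2)] arcD(1)[OF h]
  \<comment> \<open>Going left from \<open>s\<close>, this is the first of the two abscissas where
    \<open>h\<close> starts or the wedge closes.\<close>
  define m where "m = max x x1"
  have fh: "f u \<noteq> h u" if "m < u" "u < s" for u
    using noncrossing[OF g(1) h] that s g(5-7) by (auto simp: m_def)
  have hg: "h u \<noteq> g u" if "m < u" "u < s" for u
    using noncrossing[OF g(2) h] that s g(3,5-7) by (auto simp: m_def dest!: spec[of _ u])
  have "m < s" using s by (auto simp: m_def)
  have fm: "f m \<le> h m"
    by (rule less_persists_left[OF cont cont \<open>m < s\<close>]) (use F s fh in auto)
  have gm: "h m \<le> g m"
    by (rule less_persists_left[OF cont cont \<open>m < s\<close>]) (use F s hg in auto)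
  show False
  proof (cases "x < x1")
    case True
    then show False using gap arcD(3)[OF h] fm gm s by (auto simp: m_def)
  next
    case False
    then have hx: "h x = f x" using fm gm g by (auto simp: m_def)
    show False
    proof (cases "x1 = x")
      case True
      \<comment> \<open>The order at \<open>s\<close> is carried over to \<open>x + 1\<close>, where
        \<open>above\<close> compares.\<close>
      have "f (x + 1) < h (x + 1)"
        using less_right[OF F(1) F(3), of x s "x + 1"] hx s by auto
      moreover have "h (x + 1) < g (x + 1)"
        using less_right[OF F(3) F(2), of x s "x + 1"] hx s g by auto
      ultimately show False
        using gap h True hx g by (auto simp: next_above_def)
    next
      case False
      then show False
        using \<open>\<not> x < x1\<close> arcD(5)[OF h, of x] arcD(3)[OF g(1)] hx s by auto
    qed
  qed
qed

text \<open>The vertex \<open>w\<close> is a leftmost one in the closed wedge to the right of the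
  apex.\<close>

lemma ex_gap:
  assumes "d \<in> D" "d' \<in> D" "above d d'"
  shows "\<exists>e w. gap d e (fst w) \<and> w \<in> V \<and> fst d (fst w) \<le> snd w \<and> snd w \<le> fst e (fst w)"
proof -
  obtain e where e: "e \<in> D" "next_above d e" using ex_next_above[OF assms] by auto
  obtain f x y where d: "d = (f, x, y)" by (cases d)
  obtain g y' where e': "e = (g, x, y')" using e d by (cases e) (auto simp: next_above_def)
  have ab: "above (f, x, y) (g, x, y')" using e d e' by (auto simp: next_above_def)
  note fD = assms(1)[unfolded d] and gD = e(1)[unfolded e']
  have less: "f s < g s" if "x < s" for s
    using above_less[OF fD gD ab that] .
  define S where "S = {w \<in> V. x < fst w \<and> fst w \<le> y \<and> fst w \<le> y' \<and>
    f (fst w) \<le> snd w \<and> snd w \<le> g (fst w)}"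
  have "finite S" using finite_V by (auto simp: S_def)
  \<comment> \<open>The right end of the arc that stops first is a candidate.\<close>
  moreover have "(if y \<le> y' then (y, f y) else (y', g y')) \<in> S"
    using arcD[OF fD] arcD[OF gD] less[of y] less[of y'] by (auto simp: S_def)
  then have "S \<noteq> {}" by blast
  ultimately obtain w where w: "w \<in> S" "\<And>v. v \<in> S \<Longrightarrow> \<not> fst v < fst w"
    using ex_is_arg_min_if_finite[of S fst] unfolding is_arg_min_def by blast
  have "gap d e (fst w)"
    using w(1) w(2)[of "(s, t)" for s t] e fD gD by (fastforce simp: S_def d e')
  moreover have "w \<in> V \<and> fst d (fst w) \<le> snd w \<and> snd w \<le> fst e (fst w)"
    using w(1) by (simp add: S_def d e')
  ultimately show ?thesis by blast
qed

lemma above_total: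
  assumes "(f, x, y) \<in> D" "(g, x, y') \<in> D" "f x = g x"
  shows "(f, x, y) = (g, x, y') \<or> above (f, x, y) (g, x, y') \<or> above (g, x, y') (f, x, y)"
proof (cases "f = g")
  case True
  then show ?thesis using arc_unique_left assms by blast
next
  case False
  then have "f (x + 1) \<noteq> g (x + 1)"
    using meet_once[OF arcD(1)[OF assms(1)] arcD(1)[OF assms(2)] False assms(3), of "x + 1"] by auto
  then show ?thesis using assms(3) by auto
qed

text \<open>Two distinct predecessors of \<open>e\<close> share its left endpoint, so one of them
  would lie between the other and \<open>e\<close>.\<close>

lemma inj_next_above:
  assumes "d1 \<in> D" "d2 \<in> D" "e \<in> D" "next_above d1 e" "next_above d2 e"
  shows "d1 = d2"
proof -
  obtain g x y where e: "e = (g, x, y)" by (cases e)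
  obtain f1 y1 where d1: "d1 = (f1, x, y1)" using assms e by (cases d1) (auto simp: next_above_def)
  obtain f2 y2 where d2: "d2 = (f2, x, y2)" using assms e by (cases d2) (auto simp: next_above_def)
  have eq: "f1 x = f2 x" using assms by (auto simp: next_above_def e d1 d2)
  show ?thesis
    using above_total[of f1 x y1 f2 y2] eq assms by (auto simp: next_above_def d1 d2)
qed

section \<open>Charging arcs to vertices\<close>

text \<open>The charge goes to the left endpoint, where \<open>above_total\<close> leaves room for
  only one topmost arc.\<close>

lemma card_top_arcs: "card {d \<in> D. \<forall>d'\<in>D. \<not> above d d'} \<le> card V"
proof (rule card_le_if_inj_on_rel[OF finite_V, where r = "\<lambda>d w. w = (fst (snd d), fst d (fst (snd d)))"])
  show "\<exists>w. w \<in> V \<and> w = (fst (snd d), fst d (fst (snd d)))"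
    if "d \<in> {d \<in> D. \<forall>d'\<in>D. \<not> above d d'}" for d
    using that arcD(3) by (cases d) auto
next
  fix d1 d2 w
  assume d: "d1 \<in> {d \<in> D. \<forall>d'\<in>D. \<not> above d d'}" "d2 \<in> {d \<in> D. \<forall>d'\<in>D. \<not> above d d'}"
    and w: "w = (fst (snd d1), fst d1 (fst (snd d1)))" "w = (fst (snd d2), fst d2 (fst (snd d2)))"
  obtain f1 x y1 where d1: "d1 = (f1, x, y1)" by (cases d1)
  obtain f2 y2 where d2: "d2 = (f2, x, y2)" using w d1 by (cases d2) auto
  have eq: "f1 x = f2 x" using w by (auto simp: d1 d2)
  show "d1 = d2"
    using above_total[of f1 x y1 f2 y2] eq d unfolding d1 d2 by blast
qed

text \<open>The charged vertex is the right end of the lower arc. If two lower arcs on different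
  curves ended there, the higher of them would run inside the wedge of the other just before the
  vertex.\<close>

lemma card_gaps_lower:
  "card {d \<in> D. \<exists>e w. gap d e (fst w) \<and> w \<in> V \<and> snd w = fst d (fst w)} \<le> card V"
    (is "card ?A \<le> _")
proof (rule card_le_if_inj_on_rel[OF finite_V,
      where r = "\<lambda>d w. w \<in> V \<and> (\<exists>e. gap d e (fst w)) \<and> snd w = fst d (fst w)"])
  show "\<exists>w. w \<in> V \<and> w \<in> V \<and> (\<exists>e. gap d e (fst w)) \<and> snd w = fst d (fst w)" if "d \<in> ?A" for d
    using that by blast
next
  fix d1 d2 w
  assume "w \<in> V \<and> (\<exists>e. gap d1 e (fst w)) \<and> snd w = fst d1 (fst w)"
    and "w \<in> V \<and> (\<exists>e. gap d2 e (fst w)) \<and> snd w = fst d2 (fst w)"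
  then obtain e1 e2 z t where w: "(z, t) \<in> V" "gap d1 e1 z" "gap d2 e2 z" "t = fst d1 z" "t = fst d2 z"
    by (metis prod.collapse)
  obtain f1 x1 y1 where d1: "d1 = (f1, x1, y1)" by (cases d1)
  obtain f2 x2 y2 where d2: "d2 = (f2, x2, y2)" by (cases d2)
  obtain g1 u1 v1 where e1: "e1 = (g1, u1, v1)" by (cases e1)
  obtain g2 u2 v2 where e2: "e2 = (g2, u2, v2)" by (cases e2)
  note G1 = w(2)[unfolded d1 e1] and G2 = w(3)[unfolded d2 e2]
  note g1 = gapD[OF G1] and g2 = gapD[OF G2]
  \<comment> \<open>A vertex on an arc cannot be interior to it.\<close>
  have y: "y1 = z" "y2 = z"
    using arcD(5)[OF g1(1), of z] arcD(5)[OF g2(1), of z] g1 g2 w d1 d2 by force+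
  have "f1 = f2"
  proof (rule ccontr)
    assume ne: "f1 \<noteq> f2"
    have eq: "f1 z = f2 z" using w d1 d2 by auto
    \<comment> \<open>At \<open>z\<close> both upper curves are strictly above the common value of
      the lower ones, and continuity extends this to the left.\<close>
    have "\<forall>\<^sub>F s in at_left z. f1 s < g2 s \<and> f2 s < g1 s \<and> s \<in> {max x1 x2<..<z}"
      using g1 g2 eq arcD(1)
      by (intro eventually_conj eventually_at_left_less cont eventually_at_left_real) fastforce+
    then obtain s where s: "f1 s < g2 s" "f2 s < g1 s" "x1 < s" "x2 < s" "s < z"
      by (auto dest!: eventually_happens)
    have "f1 s \<noteq> f2 s"
      using meet_once[OF arcD(1)[OF g1(1)] arcD(1)[OF g2(1)] ne eq, of s] s by auto
    then show False
      by (cases "f1 s" "f2 s" rule: linorder_cases)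
        (use gap_no_arc[OF G1 g2(1), of s] gap_no_arc[OF G2 g1(1), of s] s y in auto)
  qed
  then show "d1 = d2"
    using arc_unique_right g1(1) g2(1) d1 d2 y by blast
qed

text \<open>Now the vertex is the right end of the upper arc, and of two upper arcs the lower one
  would enter the other wedge. So the upper arcs agree, and \<open>inj_next_above\<close> recovers
  the lower arc.\<close>

lemma card_gaps_upper:
  "card {d \<in> D. \<exists>e w. gap d e (fst w) \<and> w \<in> V \<and> snd w = fst e (fst w)} \<le> card V"
    (is "card ?A \<le> _")
proof (rule card_le_if_inj_on_rel[OF finite_V,
      where r = "\<lambda>d w. w \<in> V \<and> (\<exists>e. gap d e (fst w) \<and> snd w = fst e (fst w))"])
  show "\<exists>w. w \<in> V \<and> w \<in> V \<and> (\<exists>e. gap d e (fst w) \<and> snd w = fst e (fst w))" if "d \<in> ?A" for d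
    using that by blast
next
  fix d1 d2 w
  assume "w \<in> V \<and> (\<exists>e. gap d1 e (fst w) \<and> snd w = fst e (fst w))"
    and "w \<in> V \<and> (\<exists>e. gap d2 e (fst w) \<and> snd w = fst e (fst w))"
  then obtain e1 e2 z t where w: "(z, t) \<in> V" "gap d1 e1 z" "gap d2 e2 z" "t = fst e1 z" "t = fst e2 z"
    by (metis prod.collapse)
  obtain f1 x1 y1 where d1: "d1 = (f1, x1, y1)" by (cases d1)
  obtain f2 x2 y2 where d2: "d2 = (f2, x2, y2)" by (cases d2)
  obtain g1 u1 v1 where e1: "e1 = (g1, u1, v1)" by (cases e1)
  obtain g2 u2 v2 where e2: "e2 = (g2, u2, v2)" by (cases e2)
  note G1 = w(2)[unfolded d1 e1] and G2 = w(3)[unfolded d2 e2]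
  note g1 = gapD[OF G1] and g2 = gapD[OF G2]
  have y: "v1 = z" "v2 = z"
    using arcD(5)[OF g1(2), of z] arcD(5)[OF g2(2), of z] g1 g2 w e1 e2 by force+
  have "g1 = g2"
  proof (rule ccontr)
    assume ne: "g1 \<noteq> g2"
    have eq: "g1 z = g2 z" using w e1 e2 by auto
    have "\<forall>\<^sub>F s in at_left z. f1 s < g2 s \<and> f2 s < g1 s \<and> s \<in> {max x1 x2<..<z}"
      using g1(5) g2(5) g1(8)[of z] g2(8)[of z] eq
        arcD(1)[OF g1(1)] arcD(1)[OF g1(2)] arcD(1)[OF g2(1)] arcD(1)[OF g2(2)]
      by (intro eventually_conj eventually_at_left_less cont eventually_at_left_real) auto
    then obtain s where s: "f1 s < g2 s" "f2 s < g1 s" "x1 < s" "x2 < s" "s < z"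
      by (auto dest!: eventually_happens)
    have "g1 s \<noteq> g2 s"
      using meet_once[OF arcD(1)[OF g1(2)] arcD(1)[OF g2(2)] ne eq, of s] s by auto
    then show False
      by (cases "g1 s" "g2 s" rule: linorder_cases)
        (use gap_no_arc[OF G1 g2(2), of s] gap_no_arc[OF G2 g1(2), of s] s y g1(3) g2(3) in auto)
  qed
  then have "e1 = e2"
    using arc_unique_right g1(2) g2(2) e1 e2 y by blast
  then show "d1 = d2"
    using inj_next_above[of d1 d2 e1] w(2,3) d1 d2 e1 e2 by auto
qed

text \<open>Two wedges around the same vertex overlap just to its left. Neither lower arc may enter
  the other wedge, so the two coincide there, and without crossings they are the same arc.\<close>

lemma card_gaps_between:
  "card {d \<in> D. \<exists>e w. gap d e (fst w) \<and> w \<in> V \<and> fst d (fst w) < snd w \<and> snd w < fst e (fst w)}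
     \<le> card V" (is "card ?A \<le> _")
proof (rule card_le_if_inj_on_rel[OF finite_V, where r = "\<lambda>d w. w \<in> V \<and>
        (\<exists>e. gap d e (fst w) \<and> fst d (fst w) < snd w \<and> snd w < fst e (fst w))"])
  show "\<exists>w. w \<in> V \<and> w \<in> V \<and> (\<exists>e. gap d e (fst w) \<and> fst d (fst w) < snd w \<and> snd w < fst e (fst w))"
    if "d \<in> ?A" for d using that by blast
next
  fix d1 d2 w
  assume "w \<in> V \<and> (\<exists>e. gap d1 e (fst w) \<and> fst d1 (fst w) < snd w \<and> snd w < fst e (fst w))"
    and "w \<in> V \<and> (\<exists>e. gap d2 e (fst w) \<and> fst d2 (fst w) < snd w \<and> snd w < fst e (fst w))"
  then obtain e1 e2 z t where w: "(z, t) \<in> V" "gap d1 e1 z" "gap d2 e2 z"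
      "fst d1 z < t" "t < fst e1 z" "fst d2 z < t" "t < fst e2 z"
    by (metis prod.collapse)
  obtain f1 x1 y1 where d1: "d1 = (f1, x1, y1)" by (cases d1)
  obtain f2 x2 y2 where d2: "d2 = (f2, x2, y2)" by (cases d2)
  obtain g1 u1 v1 where e1: "e1 = (g1, u1, v1)" by (cases e1)
  obtain g2 u2 v2 where e2: "e2 = (g2, u2, v2)" by (cases e2)
  note G1 = w(2)[unfolded d1 e1] and G2 = w(3)[unfolded d2 e2]
  note g1 = gapD[OF G1] and g2 = gapD[OF G2]
  have "\<forall>\<^sub>F s in at_left z. f1 s < g2 s \<and> f2 s < g1 s \<and> s \<in> {max x1 x2<..<z}"
    using g1(5) g2(5) w(4-) arcD(1)[OF g1(1)] arcD(1)[OF g1(2)] arcD(1)[OF g2(1)] arcD(1)[OF g2(2)]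
    by (intro eventually_conj eventually_at_left_less cont eventually_at_left_real)
       (auto simp: d1 d2 e1 e2)
  then obtain s where s: "f1 s < g2 s" "f2 s < g1 s" "x1 < s" "x2 < s" "s < z"
    by (auto dest!: eventually_happens)
  have eq: "f1 s = f2 s"
    by (cases "f1 s" "f2 s" rule: linorder_cases)
      (use gap_no_arc[OF G1 g2(1), of s] gap_no_arc[OF G2 g1(1), of s] s g1(6) g2(6) in auto)
  have "f1 = f2"
    using noncrossing[OF g1(1) g2(1)] eq s g1(6) g2(6) by fastforce
  then show "d1 = d2"
    using arc_unique[of f1 x1 y1 x2 y2 s] g1 g2 s by (auto simp: d1 d2)
qed

text \<open>Charge an arc that is not the topmost one starting at its left endpoint to the leftmost
  vertex of the wedge between it and the next arc above it.\<close>

lemma card_plane_arcs: "card D \<le> 4 * card V"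
proof -
  let ?T = "{d \<in> D. \<forall>d'\<in>D. \<not> above d d'}"
  let ?A = "{d \<in> D. \<exists>e w. gap d e (fst w) \<and> w \<in> V \<and> snd w = fst d (fst w)}"
  let ?B = "{d \<in> D. \<exists>e w. gap d e (fst w) \<and> w \<in> V \<and> snd w = fst e (fst w)}"
  let ?C = "{d \<in> D. \<exists>e w. gap d e (fst w) \<and> w \<in> V \<and> fst d (fst w) < snd w \<and> snd w < fst e (fst w)}"
  have "D \<subseteq> (?T \<union> ?A) \<union> (?B \<union> ?C)"
  proof
    fix d assume d: "d \<in> D"
    show "d \<in> (?T \<union> ?A) \<union> (?B \<union> ?C)"
    proof (cases "d \<in> ?T")
      case False
      then obtain d' where "d' \<in> D" "above d d'" using d by auto
      from ex_gap[OF d this] obtain e w where w: "gap d e (fst w)" "w \<in> V"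
        "fst d (fst w) \<le> snd w" "snd w \<le> fst e (fst w)" by auto
      then consider "snd w = fst d (fst w)" | "snd w = fst e (fst w)"
        | "fst d (fst w) < snd w \<and> snd w < fst e (fst w)" by linarith
      then show ?thesis using w d by cases blast+
    qed auto
  qed
  then have "card D \<le> card ((?T \<union> ?A) \<union> (?B \<union> ?C))"
    using finite_D by (intro card_mono) auto
  also have "\<dots> \<le> (card ?T + card ?A) + (card ?B + card ?C)"
    by (intro order.trans[OF card_Un_le] add_mono card_Un_le)
  finally show ?thesis
    using card_top_arcs card_gaps_lower card_gaps_upper card_gaps_between by linarith
qed

end

section \<open>Incidences with pseudolines\<close>

text \<open>For \<open>p\<close> in \<open>[0, 1]\<close> the weights are the probabilities of the
  outcomes \<open>S\<close> when points are kept independently with probability \<open>p\<close>;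
  the sum is the probability that all of \<open>T\<close> is kept.\<close>

lemma sum_Pow_weights:
  fixes p :: real
  assumes "finite V" "T \<subseteq> V"
  shows "(\<Sum>S | S \<subseteq> V \<and> T \<subseteq> S. p ^ card S * (1 - p) ^ card (V - S)) = p ^ card T"
proof -
  have fin: "finite T" "finite (V - T)" using assms finite_subset by auto
  have "(\<Sum>S | S \<subseteq> V \<and> T \<subseteq> S. p ^ card S * (1 - p) ^ card (V - S)) =
    (\<Sum>R\<in>Pow (V - T). p ^ card T * (p ^ card R * (1 - p) ^ card (V - T - R)))"
  proof (rule sum.reindex_bij_witness[of _ "\<lambda>R. R \<union> T" "\<lambda>S. S - T"])
    fix S assume "S \<in> {S. S \<subseteq> V \<and> T \<subseteq> S}"
    then have S: "S \<subseteq> V" "T \<subseteq> S" by auto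
    have "card S = card T + card (S - T)"
      using S fin(1) assms(1) by (metis add_diff_inverse_nat card_Diff_subset card_mono finite_subset not_less)
    moreover have "V - T - (S - T) = V - S" using S by auto
    ultimately show "p ^ card T * (p ^ card (S - T) * (1 - p) ^ card (V - T - (S - T)))
        = p ^ card S * (1 - p) ^ card (V - S)"
      by (simp add: power_add)
  qed (use assms in auto)
  also have "\<dots> = p ^ card T * (\<Sum>R\<in>Pow (V - T). p ^ card R * (1 - p) ^ card (V - T - R))"
    by (simp add: sum_distrib_left)
  also have "(\<Sum>R\<in>Pow (V - T). p ^ card R * (1 - p) ^ card (V - T - R)) = 1"
    \<comment> \<open>Expands the product of \<open>p + (1 - p)\<close> over
      \<open>V - T\<close>.\<close>
    using prod_add[OF fin(2), of "\<lambda>_. p" "\<lambda>_. 1 - p"] by simp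
  finally show ?thesis by simp
qed

text \<open>Linearity of expectation for the number of sets \<open>T x\<close> that survive the
  sampling.\<close>

lemma sum_Pow_weights_count:
  fixes p :: real
  assumes "finite V" "finite X" "\<And>x. x \<in> X \<Longrightarrow> T x \<subseteq> V" "\<And>x. x \<in> X \<Longrightarrow> card (T x) = k"
  shows "(\<Sum>S\<in>Pow V. p ^ card S * (1 - p) ^ card (V - S) * real (card {x \<in> X. T x \<subseteq> S}))
    = p ^ k * real (card X)"
proof -
  let ?w = "\<lambda>S. p ^ card S * (1 - p) ^ card (V - S)"
  have "(\<Sum>S\<in>Pow V. ?w S * real (card {x \<in> X. T x \<subseteq> S}))
      = (\<Sum>S\<in>Pow V. \<Sum>x\<in>X. if T x \<subseteq> S then ?w S else 0)"
    using assms(2) by (intro sum.cong refl) (simp add: sum.If_cases Int_def mult.commute)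
  also have "\<dots> = (\<Sum>x\<in>X. \<Sum>S\<in>Pow V. if T x \<subseteq> S then ?w S else 0)"
    by (rule sum.swap)
  also have "\<dots> = (\<Sum>x\<in>X. p ^ k)"
  proof (rule sum.cong[OF refl])
    fix x assume x: "x \<in> X"
    have "(\<Sum>S\<in>Pow V. if T x \<subseteq> S then ?w S else 0) = (\<Sum>S | S \<subseteq> V \<and> T x \<subseteq> S. ?w S)"
      using assms(1) by (simp add: sum.If_cases Int_def)
    also have "\<dots> = p ^ k"
      using sum_Pow_weights[OF assms(1) assms(3)[OF x]] assms(4)[OF x] by simp
    finally show "(\<Sum>S\<in>Pow V. if T x \<subseteq> S then ?w S else 0) = p ^ k" .
  qed
  finally show ?thesis by simp
qed

section \<open>Crossings and the incidence bound\<close>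

context pseudolines
begin

definition crossings :: "(real \<times> real) set \<Rightarrow> (arc \<times> arc) set" where
  "crossings V = {(d, d') \<in> arcs V \<times> arcs V. crossing d d'}"

lemma finite_crossings: "finite V \<Longrightarrow> finite (crossings V)"
  using finite_subset[of "crossings V" "arcs V \<times> arcs V"] finite_arcs by (auto simp: crossings_def)

fun ends :: "arc \<Rightarrow> (real \<times> real) set" where
  "ends (f, x, y) = {(x, f x), (y, f y)}"

lemma ends_subset: "d \<in> arcs V \<Longrightarrow> ends d \<subseteq> V"
  by (cases d) (auto simp: arcs_def)

lemma card_ends: "d \<in> arcs V \<Longrightarrow> card (ends d) = 2"
  by (cases d) (auto simp: arcs_def)

text \<open>The curves meet only at an abscissa interior to both arcs, so no endpoint is shared. A
  crossing therefore survives sampling with probability \<open>p ^ 4\<close>.\<close>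

lemma card_ends_crossing:
  assumes "d \<in> arcs V" "d' \<in> arcs V" "crossing d d'"
  shows "card (ends d \<union> ends d') = 4"
proof -
  obtain f x y where d: "d = (f, x, y)" by (cases d)
  obtain g u v where d': "d' = (g, u, v)" by (cases d')
  obtain z where z: "f \<noteq> g" "x < z" "z < y" "u < z" "z < v" "f z = g z"
    using assms(3) by (auto simp: d d')
  have "f s \<noteq> g s" if "s \<noteq> z" for s
    using meet_once[of f g z s] z assms that by (auto simp: d d' arcs_def)
  then have "ends d \<inter> ends d' = {}"
    using z by (auto simp: d d')
  then show ?thesis
    using card_ends[OF assms(1)] card_ends[OF assms(2)]
    by (subst card_Un_disjoint) (auto simp: d d')
qed

text \<open>An ordered pair of curves determines the meeting abscissa, which in turn determines the
  arc on each curve.\<close>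

lemma card_crossings:
  assumes "finite V"
  shows "card (crossings V) \<le> card F ^ 2"
proof -
  have "card (crossings V) \<le> card (F \<times> F)"
  proof (rule card_inj_on_le[of "\<lambda>(d, d'). (fst d, fst d')"])
    show "inj_on (\<lambda>(d, d'). (fst d, fst d')) (crossings V)"
    proof (rule inj_onI)
      fix c1 c2 assume c12: "c1 \<in> crossings V" "c2 \<in> crossings V"
        "(\<lambda>(d, d'). (fst d, fst d')) c1 = (\<lambda>(d, d'). (fst d, fst d')) c2"
      obtain f1 x1 y1 g1 u1 v1 where c1: "c1 = ((f1, x1, y1), (g1, u1, v1))" by (metis prod.collapse)
      obtain f2 x2 y2 g2 u2 v2 where c2: "c2 = ((f2, x2, y2), (g2, u2, v2))" by (metis prod.collapse)
      have c: "((f1, x1, y1), (g1, u1, v1)) \<in> crossings V" "((f2, x2, y2), (g2, u2, v2)) \<in> crossings V"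
        and eq: "f1 = f2" "g1 = g2"
        using c12 by (auto simp: c1 c2)
      then obtain z1 z2 where z:
        "f1 \<noteq> g1" "x1 < z1" "z1 < y1" "u1 < z1" "z1 < v1" "f1 z1 = g1 z1"
        "x2 < z2" "z2 < y2" "u2 < z2" "z2 < v2" "f1 z2 = g1 z2"
        by (auto simp: crossings_def)
      have A: "(f1, x1, y1) \<in> arcs V" "(g1, u1, v1) \<in> arcs V" "(f1, x2, y2) \<in> arcs V" "(g1, u2, v2) \<in> arcs V"
        using c eq by (auto simp: crossings_def)
      then have zz: "z1 = z2" using meet_once[of f1 g1 z1 z2] z by (auto simp: arcs_def)
      show "c1 = c2"
        unfolding c1 c2 using arcs_unique[OF A(1,3), of z1] arcs_unique[OF A(2,4), of z1] z zz eq by auto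
    qed
    show "(\<lambda>(d, d'). (fst d, fst d')) ` crossings V \<subseteq> F \<times> F"
      by (auto simp: crossings_def arcs_def)
  qed (use finite_F in auto)
  then show ?thesis by (simp add: card_cartesian_product power2_eq_square)
qed

text \<open>Deleting the first arc of every surviving crossing leaves a crossing-free family, to
  which the linear bound applies with vertex set \<open>S\<close>.\<close>

lemma card_arcs_minus_crossings:
  assumes "finite V" "S \<subseteq> V"
  shows "card {d \<in> arcs V. ends d \<subseteq> S} \<le> 4 * card S
    + card {c \<in> crossings V. ends (fst c) \<union> ends (snd c) \<subseteq> S}"
proof -
  define E where "E = {d \<in> arcs V. ends d \<subseteq> S}"
  define X where "X = {c \<in> crossings V. ends (fst c) \<union> ends (snd c) \<subseteq> S}"
  have fin: "finite E" "finite X" "finite S"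
    using finite_arcs[OF assms(1)] finite_subset[OF _ finite_crossings[OF assms(1)], of X]
      finite_subset[OF assms(2,1)] by (auto simp: E_def X_def)
  interpret plane_arcs F S "E - fst ` X"
  proof
    \<comment> \<open>Interiors that avoid \<open>V\<close> also avoid its subset
      \<open>S\<close>.\<close>
    show "E - fst ` X \<subseteq> arcs S"
      using assms(2) by (auto simp: E_def arcs_def)
    show "\<not> crossing d d'" if "d \<in> E - fst ` X" "d' \<in> E - fst ` X" for d d'
    proof
      assume "crossing d d'"
      then have "(d, d') \<in> X" using that by (auto simp: X_def E_def crossings_def)
      then show False using that by force
    qed
  qed (use fin in auto)
  have "card E \<le> card (E - fst ` X) + card (fst ` X)"
    using card_mono[of "(E - fst ` X) \<union> fst ` X" E] card_Un_le[of "E - fst ` X" "fst ` X"] fin by auto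
  also have "card (fst ` X) \<le> card X" using fin by (simp add: card_image_le)
  finally show ?thesis
    using card_plane_arcs by (simp add: E_def X_def)
qed

text \<open>The previous inequality is averaged over the random sample: a point, an arc and a
  crossing survive with probabilities \<open>p\<close>, \<open>p ^ 2\<close> and
  \<open>p ^ 4\<close>. Division by \<open>p ^ 2\<close> finishes.\<close>

lemma card_arcs:
  fixes p :: real
  assumes V: "finite V" and p: "0 < p" "p \<le> 1"
  shows "real (card (arcs V)) \<le> p\<^sup>2 * real (card F) ^ 2 + 4 * real (card V) / p"
proof -
  let ?w = "\<lambda>S. p ^ card S * (1 - p) ^ card (V - S)"
  \<comment> \<open>This is \<open>card S\<close>, written with singletons to fit
    \<open>sum_Pow_weights_count\<close> with \<open>k = 1\<close>.\<close>
  let ?n = "\<lambda>S. real (card {v \<in> V. {v} \<subseteq> S})"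
  let ?e = "\<lambda>S. real (card {d \<in> arcs V. ends d \<subseteq> S})"
  let ?c = "\<lambda>S. real (card {c \<in> crossings V. ends (fst c) \<union> ends (snd c) \<subseteq> S})"
  have "(\<Sum>S\<in>Pow V. ?w S * ?e S) \<le> (\<Sum>S\<in>Pow V. ?w S * (4 * ?n S + ?c S))"
  proof (intro sum_mono mult_left_mono)
    fix S assume "S \<in> Pow V"
    then have S: "{v \<in> V. {v} \<subseteq> S} = S" "S \<subseteq> V" by auto
    show "?e S \<le> 4 * ?n S + ?c S"
      unfolding S(1) using of_nat_mono[OF card_arcs_minus_crossings[OF V S(2)], where 'a = real] by simp
  qed (use p in auto)
  also have "\<dots> = 4 * (\<Sum>S\<in>Pow V. ?w S * ?n S) + (\<Sum>S\<in>Pow V. ?w S * ?c S)"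
    by (simp only: distrib_left sum.distrib sum_distrib_left mult.left_commute[of _ 4])
  also have "(\<Sum>S\<in>Pow V. ?w S * ?n S) = p ^ 1 * real (card V)"
    by (rule sum_Pow_weights_count[OF V V]) auto
  also have "(\<Sum>S\<in>Pow V. ?w S * ?c S) = p ^ 4 * real (card (crossings V))"
  proof (rule sum_Pow_weights_count[OF V finite_crossings[OF V]])
    fix c assume "c \<in> crossings V"
    then have c: "fst c \<in> arcs V" "snd c \<in> arcs V" "crossing (fst c) (snd c)"
      by (auto simp: crossings_def)
    show "ends (fst c) \<union> ends (snd c) \<subseteq> V" using ends_subset[OF c(1)] ends_subset[OF c(2)] by blast
    show "card (ends (fst c) \<union> ends (snd c)) = 4" by (rule card_ends_crossing[OF c])
  qed
  also have "(\<Sum>S\<in>Pow V. ?w S * ?e S) = p ^ 2 * real (card (arcs V))"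
    by (rule sum_Pow_weights_count[OF V finite_arcs[OF V] ends_subset card_ends])
  finally have "p\<^sup>2 * real (card (arcs V)) \<le> 4 * p * real (card V) + p ^ 4 * real (card (crossings V))"
    by simp
  also have "\<dots> \<le> 4 * p * real (card V) + p ^ 4 * real (card F) ^ 2"
    using card_crossings[OF V] p by (intro add_left_mono mult_left_mono) (auto simp flip: of_nat_power)
  also have "\<dots> = p\<^sup>2 * (p\<^sup>2 * real (card F) ^ 2 + 4 * real (card V) / p)"
    using p by (simp add: field_simps power2_eq_square power4_eq_xxxx)
  finally show ?thesis using p by simp
qed

text \<open>An incidence is charged to the arc that starts there, and the last incidence on a curve
  to the curve itself.\<close>

lemma card_incidences_le_arcs:
  assumes V: "finite V"
  shows "card {(f, x). f \<in> F \<and> (x, f x) \<in> V} \<le> card F + card (arcs V)"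
proof -
  let ?r = "\<lambda>(f, x) b. b = Inl f \<and> (\<forall>y>x. (y, f y) \<notin> V) \<or> (\<exists>y. b = Inr (f, x, y))"
  have "card {(f, x). f \<in> F \<and> (x, f x) \<in> V} \<le> card (F <+> arcs V)"
  proof (rule card_le_if_inj_on_rel[where r = ?r])
    show "finite (F <+> arcs V)" using finite_F finite_arcs[OF V] by simp
    fix a assume "a \<in> {(f, x). f \<in> F \<and> (x, f x) \<in> V}"
    then obtain f x where a: "a = (f, x)" "f \<in> F" "(x, f x) \<in> V" by auto
    define Y where "Y = {y. x < y \<and> (y, f y) \<in> V}"
    have fY: "finite Y"
      by (rule finite_subset[of _ "fst ` V"]) (use V in \<open>force simp: Y_def\<close>)+
    show "\<exists>b. b \<in> F <+> arcs V \<and> ?r a b"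
    proof (cases "Y = {}")
      case True
      then show ?thesis using a by (intro exI[of _ "Inl f"]) (auto simp: Y_def)
    next
      case False
      define y where "y = Min Y"
      have "y \<in> Y" using fY False by (simp add: y_def)
      moreover have "z \<notin> Y" if "z < y" for z
        using that fY False by (auto simp: y_def)
      ultimately have "(f, x, y) \<in> arcs V" using a by (auto simp: arcs_def Y_def)
      then show ?thesis using a by (intro exI[of _ "Inr (f, x, y)"]) auto
    qed
  next
    fix a1 a2 b
    assume "a1 \<in> {(f, x). f \<in> F \<and> (x, f x) \<in> V}" "a2 \<in> {(f, x). f \<in> F \<and> (x, f x) \<in> V}"
      "?r a1 b" "?r a2 b"
    then show "a1 = a2"
      by (auto) (metis linorder_less_linear)+
  qed
  also have "\<dots> = card F + card (arcs V)"
    using finite_F finite_arcs[OF V] by (simp add: card_Plus)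
  finally show ?thesis .
qed

lemma card_incidences:
  fixes p :: real
  assumes "finite V" "0 < p" "p \<le> 1"
  shows "real (card {(f, x). f \<in> F \<and> (x, f x) \<in> V})
    \<le> real (card F) + p\<^sup>2 * real (card F) ^ 2 + 4 * real (card V) / p"
  using card_arcs[OF assms] card_incidences_le_arcs[OF assms(1)] by linarith

end

section \<open>Unit circles\<close>

text \<open>Agrees with the lower unit semicircle on \<open>[-4/5, 4/5]\<close>, and with a parabola outside.\<close>

definition cap :: "real \<Rightarrow> real" where
  "cap x = max (- sqrt (max 0 (1 - x\<^sup>2))) (2 * x\<^sup>2 - 47/25)"

text \<open>The slope of a supporting line of \<open>cap\<close>. At the corners over
  \<open>4/5\<close> and \<open>-4/5\<close> the slope of the circle is chosen.\<close>

definition cap_slope :: "real \<Rightarrow> real" where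
  "cap_slope x = (if \<bar>x\<bar> \<le> 4/5 then x / sqrt (1 - x\<^sup>2) else 4 * x)"

text \<open>Semicircle and parabola meet at height \<open>-3/5\<close> over \<open>4/5\<close> and
  \<open>-4/5\<close>. With \<open>t = sqrt (1 - x^2)\<close> their difference is
  \<open>2 * (t - 3/5) * (t + 1/10)\<close>, whose sign decides the maximum here and in
  \<open>cap_outer\<close>.\<close>

lemma cap_inner:
  assumes "\<bar>x\<bar> \<le> 4/5"
  shows "cap x = - sqrt (1 - x\<^sup>2)" "3/5 \<le> sqrt (1 - x\<^sup>2)"
proof -
  have x: "x\<^sup>2 \<le> (4/5)\<^sup>2" using assms power_mono[of "\<bar>x\<bar>" "4/5" 2] by simp
  then show t: "3/5 \<le> sqrt (1 - x\<^sup>2)" by (intro real_le_rsqrt) (simp add: power2_eq_square)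
  define t where "t = sqrt (1 - x\<^sup>2)"
  have "t\<^sup>2 = 1 - x\<^sup>2" using x by (simp add: t_def power2_eq_square)
  moreover have "0 \<le> (t - 3/5) * (t + 1/10)" using t unfolding t_def by (intro mult_nonneg_nonneg) auto
  ultimately have "2 * x\<^sup>2 - 47/25 \<le> - t" by (simp add: algebra_simps power2_eq_square)
  then show "cap x = - sqrt (1 - x\<^sup>2)" using x by (simp add: cap_def t_def power2_eq_square)
qed

lemma cap_outer:
  assumes "4/5 \<le> \<bar>x\<bar>"
  shows "cap x = 2 * x\<^sup>2 - 47/25"
proof (cases "\<bar>x\<bar> \<le> 1")
  case True
  have x: "(4/5)\<^sup>2 \<le> x\<^sup>2" using assms by (subst abs_le_square_iff[symmetric]) simp
  have x1: "x\<^sup>2 \<le> 1" using True by (simp add: abs_square_le_1)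
  define t where "t = sqrt (1 - x\<^sup>2)"
  have "0 \<le> t" using x1 by (simp add: t_def)
  moreover have "t \<le> 3/5"
    unfolding t_def by (rule real_le_lsqrt) (use x in \<open>auto simp: power2_eq_square\<close>)
  ultimately have t: "0 \<le> t" "t \<le> 3/5" by auto
  have "t\<^sup>2 = 1 - x\<^sup>2" using x1 by (simp add: t_def)
  moreover have "(t - 3/5) * (t + 1/10) \<le> 0" using t by (intro mult_nonpos_nonneg) auto
  ultimately have "- t \<le> 2 * x\<^sup>2 - 47/25" by (simp add: algebra_simps power2_eq_square)
  then show ?thesis using x1 by (simp add: cap_def t_def)
next
  case False
  then have "1 < x\<^sup>2" by (simp add: abs_square_le_1 flip: not_le)
  then show ?thesis by (simp add: cap_def)
qed

text \<open>Strict convexity through supporting lines. A tangent of the parabola is compared with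
  the parabola; a tangent of the circle is compared with the circle for
  \<open>\<bar>y\<bar> \<le> 1\<close> and with the parabola beyond.\<close>

lemma cap_above_tangent:
  assumes "x \<noteq> y"
  shows "cap x + cap_slope x * (y - x) < cap y"
proof (cases "\<bar>x\<bar> \<le> 4/5")
  case False
  have "0 < 2 * (y - x)\<^sup>2" using assms by simp
  then have "2 * x\<^sup>2 - 47/25 + 4 * x * (y - x) < 2 * y\<^sup>2 - 47/25"
    by (simp add: algebra_simps power2_eq_square)
  also have "\<dots> \<le> cap y" by (simp add: cap_def)
  finally show ?thesis using False cap_outer[of x] by (simp add: cap_slope_def)
next
  case True
  define t where "t = sqrt (1 - x\<^sup>2)"
  have t: "3/5 \<le> t" "cap x = - t" using cap_inner[OF True] by (auto simp: t_def)
  have "0 \<le> 1 - x\<^sup>2" using True by (simp add: abs_square_le_1)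
  then have tx: "t\<^sup>2 + x\<^sup>2 = 1" by (simp add: t_def)
  have slope: "cap_slope x = x / t" using True by (simp add: cap_slope_def t_def)
  have "cap x + cap_slope x * (y - x) = (x * y - (t\<^sup>2 + x\<^sup>2)) / t"
    unfolding slope using t by (simp add: field_simps power2_eq_square)
  then have tangent: "cap x + cap_slope x * (y - x) = (x * y - 1) / t" by (simp only: tx)
  show ?thesis
  proof (cases "\<bar>y\<bar> \<le> 1")
    case y: True
    define u where "u = sqrt (1 - y\<^sup>2)"
    have u: "0 \<le> u" "u\<^sup>2 + y\<^sup>2 = 1" using y by (auto simp: u_def abs_square_le_1)
    \<comment> \<open>The distinct unit vectors \<open>(x, t)\<close> and \<open>(y, u)\<close> have
      inner product below 1.\<close>
    have "0 < (x - y)\<^sup>2 + (t - u)\<^sup>2" using assms by (simp add: add_pos_nonneg)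
    also have "\<dots> = (t\<^sup>2 + x\<^sup>2) + (u\<^sup>2 + y\<^sup>2) - 2 * (x * y + t * u)"
      by (simp add: power2_eq_square algebra_simps)
    finally have "x * y - 1 < - t * u" using tx u by simp
    then have "(x * y - 1) / t < - u" using t(1) by (simp add: field_simps)
    also have "- u \<le> cap y" using y by (simp add: cap_def u_def abs_square_le_1)
    finally show ?thesis using tangent by simp
  next
    case False
    have "x * y \<le> 4/5 * \<bar>y\<bar>"
      using True mult_right_mono[of "\<bar>x\<bar>" "4/5" "\<bar>y\<bar>"] abs_ge_self[of "x * y"] by (simp add: abs_mult)
    define q where "q = 2 * y\<^sup>2 - 47/25"
    have pos: "0 \<le> q" using False one_less_power[of "\<bar>y\<bar>" 2] by (simp add: q_def)
    \<comment> \<open>The product is smaller than 5/3 times the difference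
      \<open>3/5 * q - (4/5 * \<bar>y\<bar> - 1)\<close> that has to be positive.\<close>
    have "0 < (\<bar>y\<bar> - 1) * (2 * \<bar>y\<bar> + 2/3)" using False by (intro mult_pos_pos) auto
    also have "\<dots> = 2 * \<bar>y\<bar>\<^sup>2 - 4/3 * \<bar>y\<bar> - 2/3"
      unfolding power2_eq_square by (simp add: field_simps del: abs_mult_self_eq)
    finally have "4/5 * \<bar>y\<bar> - 1 < 3/5 * q" by (simp add: q_def)
    also have "\<dots> \<le> t * q" by (rule mult_right_mono[OF t(1) pos])
    finally have "x * y - 1 < q * t" using \<open>x * y \<le> _\<close> by (simp add: mult.commute)
    then have "(x * y - 1) / t < 2 * y\<^sup>2 - 47/25"
      using t(1) by (subst pos_divide_less_eq) (auto simp: q_def)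
    also have "\<dots> \<le> cap y" by (simp add: cap_def)
    finally show ?thesis using tangent by simp
  qed
qed

lemma cap_increment_strict_mono:
  assumes "h > 0" "x < y"
  shows "cap (x + h) - cap x < cap (y + h) - cap y"
proof -
  define k where "k = y - x"
  have k: "k > 0" "y = x + k" using assms by (auto simp: k_def)
  \<comment> \<open>Strict Jensen inequality: in the weighted sum of two supporting-line
    inequalities at \<open>x + a\<close> the slope cancels. Adding the instances
    \<open>(h, k)\<close> and \<open>(k, h)\<close> gives the claim.\<close>
  have *: "(a + b) * cap (x + a) < b * cap x + a * cap (x + a + b)" if "a > 0" "b > 0" for a b
  proof -
    let ?d = "cap_slope (x + a)"
    have "cap (x + a) - ?d * a < cap x" "cap (x + a) + ?d * b < cap (x + a + b)"
      using cap_above_tangent[of "x + a" x] cap_above_tangent[of "x + a" "x + a + b"] that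
      by (auto simp: algebra_simps)
    then have "b * (cap (x + a) - ?d * a) + a * (cap (x + a) + ?d * b) < b * cap x + a * cap (x + a + b)"
      using that by (intro add_strict_mono mult_strict_left_mono) auto
    then show ?thesis by (simp add: algebra_simps)
  qed
  have "(h + k) * (cap (x + h) + cap (x + k)) < (h + k) * (cap x + cap (x + h + k))"
    using *[of h k] *[of k h] assms k by (simp add: algebra_simps)
  then have "cap (x + h) + cap (x + k) < cap x + cap (x + h + k)"
    using assms k by (simp add: mult_less_cancel_left_pos)
  then show ?thesis by (simp add: k add.assoc add.left_commute add.commute)
qed

section \<open>Translated caps as pseudolines\<close>

definition cap_at :: "real \<times> real \<Rightarrow> real \<Rightarrow> real" where
  "cap_at a x = snd a + cap (x - fst a)"

text \<open>If the abscissas of \<open>a\<close> and \<open>b\<close> differ, the difference of the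
  two curves is strictly monotone; if they agree, the curves are disjoint vertical
  translates.\<close>

lemma cap_at_meet_once:
  assumes "a \<noteq> b" "cap_at a x = cap_at b x" "cap_at a y = cap_at b y"
  shows "x = y"
proof -
  have *: "cap_at a x - cap_at b x < cap_at a y - cap_at b y" if "fst a < fst b" "x < y" for a b x y
    using cap_increment_strict_mono[of "fst b - fst a" "x - fst b" "y - fst b"] that
    by (simp add: cap_at_def)
  show ?thesis
  proof (cases "fst a = fst b")
    case True
    then show ?thesis using assms by (auto simp: cap_at_def prod_eq_iff)
  next
    case False
    then show ?thesis
      using *[of a b x y] *[of a b y x] *[of b a x y] *[of b a y x] assms(2,3)
      by (cases x y rule: linorder_cases; cases "fst a < fst b") auto
  qed
qed

lemma inj_cap_at: "inj cap_at"
  using cap_at_meet_once[of _ _ 0 1] by (intro injI) (metis zero_neq_one)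

lemma card_cap_incidences:
  fixes p :: real and A V :: "(real \<times> real) set"
  assumes A: "finite A" and V: "finite V" and p: "0 < p" "p \<le> 1"
  shows "real (card {(a, v) \<in> A \<times> V. snd v = cap_at a (fst v)})
    \<le> real (card A) + p\<^sup>2 * real (card A) ^ 2 + 4 * real (card V) / p"
proof -
  interpret pseudolines "cap_at ` A"
  proof
    show "finite (cap_at ` A)" using A by simp
    show "continuous_on UNIV f" if "f \<in> cap_at ` A" for f
    proof -
      from that obtain a where "f = cap_at a" by auto
      then have "f = (\<lambda>x. snd a + cap (x - fst a))" by (simp add: cap_at_def fun_eq_iff)
      then show ?thesis unfolding cap_def by (auto intro!: continuous_intros)
    qed
    show "x = y" if "f \<in> cap_at ` A" "g \<in> cap_at ` A" "f \<noteq> g" "f x = g x" "f y = g y" for f g x y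
    proof -
      from that obtain a b where "f = cap_at a" "g = cap_at b" by auto
      then show ?thesis using that cap_at_meet_once[of a b x y] by auto
    qed
  qed
  have "card {(a, v) \<in> A \<times> V. snd v = cap_at a (fst v)}
      = card {(f, x). f \<in> cap_at ` A \<and> (x, f x) \<in> V}"
  proof (rule bij_betw_same_card[of "\<lambda>(a, v). (cap_at a, fst v)"])
    show "bij_betw (\<lambda>(a, v). (cap_at a, fst v)) {(a, v) \<in> A \<times> V. snd v = cap_at a (fst v)}
      {(f, x). f \<in> cap_at ` A \<and> (x, f x) \<in> V}"
      unfolding bij_betw_def
    proof
      show "inj_on (\<lambda>(a, v). (cap_at a, fst v)) {(a, v) \<in> A \<times> V. snd v = cap_at a (fst v)}"
        using injD[OF inj_cap_at] by (fastforce intro!: inj_onI)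
      show "(\<lambda>(a, v). (cap_at a, fst v)) ` {(a, v) \<in> A \<times> V. snd v = cap_at a (fst v)}
        = {(f, x). f \<in> cap_at ` A \<and> (x, f x) \<in> V}"
        by (force simp: image_iff)
    qed
  qed
  moreover have "card (cap_at ` A) = card A"
    using card_image[OF inj_on_subset[OF inj_cap_at]] by auto
  ultimately show ?thesis using card_incidences[OF V p] by simp
qed

text \<open>The coordinates of a unit vector cannot both exceed \<open>4/5\<close> in absolute
  value, as \<open>32/25 > 1\<close>. A coordinate within this bound serves as abscissa, and a
  reflection settles the sign of the other.\<close>

lemma dist_1_cases:
  fixes p q :: "real ^ 2"
  assumes "dist p q = 1"
  shows "q $ 2 = cap_at (p $ 1, p $ 2) (q $ 1) \<or> - q $ 2 = cap_at (p $ 1, - p $ 2) (q $ 1) \<or>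
    q $ 1 = cap_at (p $ 2, p $ 1) (q $ 2) \<or> - q $ 1 = cap_at (p $ 2, - p $ 1) (q $ 2)"
proof -
  have *: "v = cap u \<or> - v = cap u" if "\<bar>u\<bar> \<le> 4/5" "u\<^sup>2 + v\<^sup>2 = 1" for u v :: real
  proof -
    have "1 - u\<^sup>2 = v\<^sup>2" using that(2) by simp
    then have "sqrt (1 - u\<^sup>2) = \<bar>v\<bar>" by simp
    then show ?thesis using cap_inner(1)[OF that(1)] by (auto simp: abs_if)
  qed
  define u v where "u = q $ 1 - p $ 1" and "v = q $ 2 - p $ 2"
  have uv: "u\<^sup>2 + v\<^sup>2 = 1"
    using assms by (simp add: dist_vec_def L2_set_def sum_2 u_def v_def dist_real_def power2_commute)
  have "\<bar>u\<bar> \<le> 4/5 \<or> \<bar>v\<bar> \<le> 4/5"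
  proof (rule ccontr)
    assume "\<not> ?thesis"
    then have "(4/5)\<^sup>2 < u\<^sup>2" "(4/5)\<^sup>2 < v\<^sup>2"
      using power_strict_mono[of "4/5" "\<bar>u\<bar>" 2] power_strict_mono[of "4/5" "\<bar>v\<bar>" 2] by auto
    then show False using uv by (simp add: power2_eq_square)
  qed
  then show ?thesis
    using *[of u v] *[of v u] uv by (auto simp: cap_at_def u_def v_def add.commute)
qed

lemma card_transformed_incidences:
  fixes A P :: "(real ^ 2) set" and T :: "real ^ 2 \<Rightarrow> real \<times> real" and p :: real
  assumes "finite A" "finite P" "inj T" "0 < p" "p \<le> 1"
  shows "real (card {(a, q) \<in> A \<times> P. snd (T q) = cap_at (T a) (fst (T q))})
    \<le> real (card A) + p\<^sup>2 * real (card A) ^ 2 + 4 * real (card P) / p"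
proof -
  have "card {(a, q) \<in> A \<times> P. snd (T q) = cap_at (T a) (fst (T q))}
      \<le> card {(a, v) \<in> T ` A \<times> T ` P. snd v = cap_at a (fst v)}"
  proof (rule card_inj_on_le[of "map_prod T T"])
    show "inj_on (map_prod T T) {(a, q) \<in> A \<times> P. snd (T q) = cap_at (T a) (fst (T q))}"
      using inj_on_subset[OF prod.inj_map[OF assms(3,3)]] by blast
    show "finite {(a, v) \<in> T ` A \<times> T ` P. snd v = cap_at a (fst v)}"
      by (rule finite_subset[of _ "T ` A \<times> T ` P"]) (use assms in auto)
  qed auto
  moreover have "card (T ` A) = card A" "card (T ` P) = card P"
    using card_image[OF inj_on_subset[OF assms(3)]] by auto
  ultimately show ?thesis
    using card_cap_incidences[of "T ` A" "T ` P" p] assms by simp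
qed

lemma card_unit_incidences:
  fixes A P :: "(real ^ 2) set" and p :: real
  assumes "finite A" "finite P" "0 < p" "p \<le> 1"
  shows "real (card {(a, q) \<in> A \<times> P. dist a q = 1})
    \<le> 4 * (real (card A) + p\<^sup>2 * real (card A) ^ 2 + 4 * real (card P) / p)"
proof -
  let ?I = "\<lambda>T. {(a, q) \<in> A \<times> P. snd (T q) = cap_at (T a) (fst (T q))}"
  let ?B = "real (card A) + p\<^sup>2 * real (card A) ^ 2 + 4 * real (card P) / p"
  \<comment> \<open>The coordinate changes behind the four cases of
    \<open>dist_1_cases\<close>.\<close>
  let ?T1 = "\<lambda>q :: real ^ 2. (q $ 1, q $ 2)"
  let ?T2 = "\<lambda>q :: real ^ 2. (q $ 1, - q $ 2)"
  let ?T3 = "\<lambda>q :: real ^ 2. (q $ 2, q $ 1)"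
  let ?T4 = "\<lambda>q :: real ^ 2. (q $ 2, - q $ 1)"
  have inj: "inj ?T1" "inj ?T2" "inj ?T3" "inj ?T4"
    by (auto intro!: injI simp: vec_eq_iff forall_2)
  have B: "real (card (?I T)) \<le> ?B" if "inj T" for T
    by (rule card_transformed_incidences[OF assms(1,2) that assms(3,4)])
  have "card {(a, q) \<in> A \<times> P. dist a q = 1} \<le> card ((?I ?T1 \<union> ?I ?T2) \<union> (?I ?T3 \<union> ?I ?T4))"
  proof (rule card_mono)
    show "finite ((?I ?T1 \<union> ?I ?T2) \<union> (?I ?T3 \<union> ?I ?T4))"
      by (rule finite_subset[of _ "A \<times> P"]) (use assms in auto)
    show "{(a, q) \<in> A \<times> P. dist a q = 1} \<subseteq> (?I ?T1 \<union> ?I ?T2) \<union> (?I ?T3 \<union> ?I ?T4)"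
      using dist_1_cases by auto
  qed
  also have "\<dots> \<le> (card (?I ?T1) + card (?I ?T2)) + (card (?I ?T3) + card (?I ?T4))"
    by (intro order.trans[OF card_Un_le] add_mono card_Un_le)
  finally have "real (card {(a, q) \<in> A \<times> P. dist a q = 1})
      \<le> real (card (?I ?T1)) + real (card (?I ?T2)) + (real (card (?I ?T3)) + real (card (?I ?T4)))"
    by (simp flip: of_nat_add)
  also have "\<dots> \<le> (?B + ?B) + (?B + ?B)"
    by (rule add_mono[OF add_mono[OF B[OF inj(1)] B[OF inj(2)]] add_mono[OF B[OF inj(3)] B[OF inj(4)]]])
  finally show ?thesis by simp
qed

section \<open>Degrees, unit distances and the final choice of constants\<close>

lemma card_unit_distance_pairs_le:
  assumes "finite P"
  shows "card (unit_distance_pairs P) \<le> (\<Sum>p\<in>P. card (unit_neighbours P p))"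
proof -
  let ?S = "SIGMA p:P. unit_neighbours P p"
  have fin: "finite (unit_neighbours P p)" for p
    using assms by (simp add: unit_neighbours_def)
  have "unit_distance_pairs P \<subseteq> (\<lambda>(p, q). {p, q}) ` ?S"
  proof
    fix e assume "e \<in> unit_distance_pairs P"
    then obtain p q where pq: "e = {p, q}" "p \<in> P" "q \<in> P" "dist p q = 1"
      by (auto simp: unit_distance_pairs_def)
    then have "(p, q) \<in> ?S" by (auto simp: unit_neighbours_def)
    then show "e \<in> (\<lambda>(p, q). {p, q}) ` ?S" using pq(1) by force
  qed
  then have "card (unit_distance_pairs P) \<le> card ?S"
    using assms fin by (intro surj_card_le) auto
  also have "\<dots> = (\<Sum>p\<in>P. card (unit_neighbours P p))"
    using assms fin by (simp add: card_SigmaI)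
  finally show ?thesis .
qed

lemma sum_unit_neighbours:
  assumes "finite A" "finite P"
  shows "(\<Sum>p\<in>A. card (unit_neighbours P p)) = card {(a, q) \<in> A \<times> P. dist a q = 1}"
proof -
  have "{(a, q) \<in> A \<times> P. dist a q = 1} = (SIGMA p:A. unit_neighbours P p)"
    by (auto simp: unit_neighbours_def)
  then show ?thesis using assms by (simp add: card_SigmaI unit_neighbours_def)
qed

theorem proposition1p4:
  shows "\<forall>c1 :: real. c1 > 0 \<longrightarrow>
    (\<exists>(c2 :: real) (c3 :: real) (n0 :: nat). c2 > 0 \<and> c3 > 0 \<and>
      (\<forall>n \<ge> n0. \<forall>P :: (real ^ 2) set.
        finite P \<and> card P = n \<and>
        real (card (unit_distance_pairs P)) \<ge> c1 * real n powr (4 / 3) \<longrightarrow>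
        real (card {p \<in> P. real (card (unit_neighbours P p)) \<ge> c3 * real n powr (1 / 3)})
          \<ge> c2 * real n))"
proof (intro allI impI)
  fix c1 :: real assume c1: "c1 > 0"
  \<comment> \<open>The three terms of the incidence bound will add up to
    \<open>4 * (1 + 1 + 4) = 24\<close> times \<open>r ^ 4 / K\<close>; the 60 makes
    \<open>24 / K\<close> at most \<open>2/5 * c1\<close>.\<close>
  define K where "K = max 1 (60 / c1)"
  have K: "1 \<le> K" "60 / c1 \<le> K" by (auto simp: K_def)
  have "24 / K < c1 / 2"
    using K c1 by (simp add: field_simps)
  \<comment> \<open>Ensures \<open>K ^ 3 \<le> n\<close>, hence a sampling probability
    \<open>K / r\<close> of at most 1.\<close>
  define n0 where "n0 = Suc (nat \<lceil>K ^ 3\<rceil>)"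
  have main: "real (card {p \<in> P. real (card (unit_neighbours P p)) \<ge> c1 / 2 * real n powr (1 / 3)})
      \<ge> 1 / K ^ 2 * real n"
    if n: "n \<ge> n0" and P: "finite P" "card P = n"
      and pairs: "real (card (unit_distance_pairs P)) \<ge> c1 * real n powr (4 / 3)"
    for n and P :: "(real ^ 2) set"
  proof (rule ccontr)
    define A where "A = {p \<in> P. real (card (unit_neighbours P p)) \<ge> c1 / 2 * real n powr (1 / 3)}"
    define m where "m = real (card A)"
    define r where "r = real n powr (1 / 3)"
    assume "\<not> ?thesis"
    then have m: "0 \<le> m" "m < real n / K\<^sup>2" by (auto simp: A_def m_def)
    have npos: "real n > 0" using n by (simp add: n0_def)
    have Kn: "K ^ 3 \<le> real n" using n by (simp add: n0_def) linarith
    have r0: "r > 0" using npos by (simp add: r_def)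
    have r3: "r ^ 3 = real n" using npos by (simp add: r_def powr_power)
    have r4: "real n powr (4 / 3) = r ^ 4" using npos by (simp add: r_def powr_power)
    have Kr: "K \<le> r"
      using power_mono_iff[of K r 3] Kn r3 r0 K by simp
    \<comment> \<open>With this \<open>p\<close> the term \<open>4 * n / p\<close> is
      \<open>4 * r ^ 4 / K\<close>, and \<open>m < n / K^2\<close> still keeps
      \<open>p^2 * m^2\<close> below \<open>r ^ 4 / K\<close>.\<close>
    define p where "p = K / r"
    have p: "0 < p" "p \<le> 1" using Kr K r0 by (auto simp: p_def)
    have finA: "finite A" using P by (simp add: A_def)
    have high: "real (\<Sum>q\<in>A. card (unit_neighbours P q)) \<le> 4 * (m + p\<^sup>2 * m ^ 2 + 4 * real n / p)"
      using card_unit_incidences[OF finA P(1) p] sum_unit_neighbours[OF finA P(1)] P(2)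
      by (simp add: m_def)
    \<comment> \<open>Points below the degree threshold contribute at most half of
      \<open>c1 * r ^ 4\<close>, so \<open>A\<close> must supply the other half.\<close>
    have "real (\<Sum>q\<in>P - A. card (unit_neighbours P q)) \<le> (\<Sum>q\<in>P - A. c1 / 2 * r)"
      unfolding of_nat_sum by (intro sum_mono) (auto simp: A_def r_def)
    also have "\<dots> \<le> real n * (c1 / 2 * r)"
      using c1 r0 P card_mono[of P "P - A"] by (auto intro!: mult_right_mono)
    also have "\<dots> = c1 / 2 * r ^ 4" by (simp flip: r3 add: power_def numeral_eq_Suc)
    finally have low: "real (\<Sum>q\<in>P - A. card (unit_neighbours P q)) \<le> c1 / 2 * r ^ 4" .
    have "c1 * r ^ 4 \<le> real (\<Sum>q\<in>P. card (unit_neighbours P q))"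
      using pairs card_unit_distance_pairs_le[OF P(1)] r4 by (smt (verit) of_nat_le_iff)
    also have "\<dots> = real (\<Sum>q\<in>P - A. card (unit_neighbours P q)) + real (\<Sum>q\<in>A. card (unit_neighbours P q))"
      using sum.subset_diff[of A P "\<lambda>q. card (unit_neighbours P q)"] P by (simp add: A_def)
    finally have lower: "c1 / 2 * r ^ 4 \<le> 4 * (m + p\<^sup>2 * m ^ 2 + 4 * real n / p)"
      using low high by linarith
    have KK: "1 / K\<^sup>2 \<le> 1 / K" using K by (simp add: field_simps power2_eq_square)
    have "m \<le> r ^ 3 / K\<^sup>2" using m r3 by simp
    also have "\<dots> \<le> r ^ 4 / K\<^sup>2"
      using Kr K by (intro divide_right_mono power_increasing) auto
    also have "\<dots> \<le> r ^ 4 / K"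
      using mult_left_mono[OF KK, of "r ^ 4"] r0 by simp
    finally have m1: "m \<le> r ^ 4 / K" .
    have "p\<^sup>2 * m\<^sup>2 \<le> p\<^sup>2 * (r ^ 3 / K\<^sup>2)\<^sup>2"
      using m r3 by (intro mult_left_mono power_mono) auto
    also have "\<dots> = r ^ 4 / K\<^sup>2"
      using r0 K by (simp add: p_def field_simps power2_eq_square power3_eq_cube power4_eq_xxxx)
    also have "\<dots> \<le> r ^ 4 / K"
      using mult_left_mono[OF KK, of "r ^ 4"] r0 by simp
    finally have m2: "p\<^sup>2 * m\<^sup>2 \<le> r ^ 4 / K" .
    have "4 * real n / p = 4 * (r ^ 4 / K)"
      using r0 K by (simp add: p_def field_simps power3_eq_cube power4_eq_xxxx flip: r3)
    then have "c1 / 2 * r ^ 4 \<le> 24 / K * r ^ 4" using lower m1 m2 by simp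
    moreover have "24 / K * r ^ 4 < c1 / 2 * r ^ 4"
      using \<open>24 / K < c1 / 2\<close> r0 by (intro mult_strict_right_mono) auto
    ultimately show False by linarith
  qed
  show "\<exists>(c2 :: real) (c3 :: real) (n0 :: nat). c2 > 0 \<and> c3 > 0 \<and>
      (\<forall>n \<ge> n0. \<forall>P :: (real ^ 2) set.
        finite P \<and> card P = n \<and>
        real (card (unit_distance_pairs P)) \<ge> c1 * real n powr (4 / 3) \<longrightarrow>
        real (card {p \<in> P. real (card (unit_neighbours P p)) \<ge> c3 * real n powr (1 / 3)})
          \<ge> c2 * real n)"
    using main c1 K by (intro exI[of _ "1 / K ^ 2"] exI[of _ "c1 / 2"] exI[of _ n0]) auto
qed

end
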